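(* Let $f$ and $g$ be two nonzero polynomials in the variables $x,y$ with complex coefficients. If $\mathrm{Trop}(f) \cap \mathrm{Trop}(g) = \emptyset$, then $f$ and $g$ have no common factor, i.e. there is no non-unit of the Laurent polynomial ring $\mathbb{C}[x^{\pm 1},y^{\pm 1}]$ (no Laurent polynomial with at least two monomials) dividing both $f$ and $g$ in that ring.
   Context: For $f(x,y) = \sum_{(i,j)\in A} c_{i,j} x^i y^j$ with all $c_{i,j}\in\mathbb{C}^* = \mathbb{C}\setminus\{0\}$, the finite set $A\subset\mathbb{Z}^2$ is the support of $f$ and the convex hull $P$ of $A$ is the Newton polygon of $f$. Let $\langle (i,j),(u,v)\rangle = iu+jv$ be the standard inner product. The normal cone to an edge of $P$ spanned by $\mathbf{p}_1$ and $\mathbf{p}_2$ is $$\{\mathbf{v}\in\mathbb{R}^2\setminus\{0\} \mid \langle \mathbf{p}_1,\mathbf{v}\rangle = \langle \mathbf{p}_2,\mathbf{v}\rangle = \min_{\mathbf{q}\in P}\langle \mathbf{q},\mathbf{v}\rangle\}.$$ $\mathrm{Trop}(f)$ denotes the set of all vectors lying in the normal cones to the edges of the Newton polygon of $f$ (the inner normals to the edges). The domain of the polynomials is restricted to the torus $(\mathbb{C}^* )^2$, so monomial factors are disregarded. *)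

theory Defs
  imports "HOL-Analysis.Analysis" "HOL-Library.Poly_Mapping"
begin

text \<open>
  The group algebra of the additive group of pairs of integers over the complex numbers: the value
  of \<open>f\<close> at \<open>(i, j)\<close> is the coefficient of \<open>x\<^sup>i y\<^sup>j\<close>, multiplication is convolution, and
  \<open>Poly_Mapping.keys f\<close> is the support of \<open>f\<close>. Hence \<open>dvd\<close> at this type is divisibility of
  Laurent polynomials.
\<close>

type_synonym laurent2 = "(int \<times> int) \<Rightarrow>\<^sub>0 complex"

definition newton_polygon :: "laurent2 \<Rightarrow> (real \<times> real) set" where
  "newton_polygon f = convex hull ((\<lambda>(i, j). (real_of_int i, real_of_int j)) ` Poly_Mapping.keys f)"

definition edge_normal_cone ::
    "(real \<times> real) set \<Rightarrow> real \<times> real \<Rightarrow> real \<times> real \<Rightarrow> (real \<times> real) set" where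
  "edge_normal_cone P p1 p2 =
     {v. v \<noteq> 0 \<and> p1 \<bullet> v = p2 \<bullet> v \<and> is_arg_min (\<lambda>q. q \<bullet> v) (\<lambda>q. q \<in> P) p1}"

text \<open>
  An edge is a face of affine dimension one, so a Newton polygon that degenerates to a segment
  is its own edge (with both normal directions), and one that is a single point has no edges.
\<close>

definition Trop :: "laurent2 \<Rightarrow> (real \<times> real) set" where
  "Trop f = {v. \<exists>p1 p2. closed_segment p1 p2 edge_of newton_polygon f \<and>
                        v \<in> edge_normal_cone (newton_polygon f) p1 p2}"

end

theory Submission
  imports Defs
begin

text \<open>
  A vector \<open>v \<noteq> 0\<close> lies in \<open>Trop f\<close> as soon as the linear form \<open>\<langle>_, v\<rangle>\<close> attains its minimum on
  the support of \<open>f\<close> at two exponents. Every support with two points has such a \<open>v\<close>, and the property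
  passes from \<open>h\<close> to every nonzero multiple \<open>h * k\<close>: breaking ties of \<open>\<langle>_, v\<rangle>\<close> by the two
  orientations of a perpendicular form gives two different vertices of the product whose
  coefficients cannot cancel. Hence a common factor with two monomials yields a common point
  of \<open>Trop f\<close> and \<open>Trop g\<close>.
\<close>

definition exponent_vector :: "int \<times> int \<Rightarrow> real \<times> real" where
  "exponent_vector = (\<lambda>(i, j). (real_of_int i, real_of_int j))"

text \<open>The condition concerns the finite support instead of the polygon, so existence and
  products become combinatorics of exponents; faces enter only in the passage to
  \<open>Trop\<close>.\<close>

definition min_attained_twice :: "(int \<times> int) set \<Rightarrow> real \<times> real \<Rightarrow> bool" where
  "min_attained_twice K v \<longleftrightarrow>
     (\<exists>p\<in>K. \<exists>q\<in>K. p \<noteq> q \<and> exponent_vector p \<bullet> v = exponent_vector q \<bullet> v \<and>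
        (\<forall>r\<in>K. exponent_vector p \<bullet> v \<le> exponent_vector r \<bullet> v))"

lemma inner_exponent_vector:
  "exponent_vector p \<bullet> v = real_of_int (fst p) * fst v + real_of_int (snd p) * snd v"
  by (simp add: exponent_vector_def split_beta inner_prod_def)

lemma exponent_vector_add: "exponent_vector (p + q) = exponent_vector p + exponent_vector q"
  by (simp add: exponent_vector_def split_beta)

lemma exponent_vector_eq_iff: "exponent_vector p = exponent_vector q \<longleftrightarrow> p = q"
  by (simp add: exponent_vector_def split_beta prod_eq_iff)

lemma newton_polygon_eq: "newton_polygon f = convex hull (exponent_vector ` Poly_Mapping.keys f)"
  by (simp add: newton_polygon_def exponent_vector_def)

lemma lexicographic_minimum_exists:
  fixes u w :: "'a \<Rightarrow> 'b::linorder"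
  assumes "finite K" and "K \<noteq> {}"
  obtains a where "a \<in> K" "\<And>q. q \<in> K \<Longrightarrow> u a < u q \<or> u a = u q \<and> w a \<le> w q"
proof -
  define L where "L = {x \<in> K. u x = Min (u ` K)}"
  have "Min (u ` K) \<in> u ` K" using assms by simp
  then obtain x where "x \<in> K" "u x = Min (u ` K)" by force
  then have "L \<noteq> {}" "finite L" using assms(1) by (auto simp: L_def)
  then have "Min (w ` L) \<in> w ` L" by simp
  then obtain a where a: "a \<in> L" "w a = Min (w ` L)" by force
  show ?thesis
  proof
    show "a \<in> K" using a by (simp add: L_def)
    fix q assume q: "q \<in> K"
    have "u a \<le> u q" using a q assms by (simp add: L_def)
    moreover have "w a \<le> w q" if "u a = u q"
    proof -
      have "q \<in> L" using that a q by (simp add: L_def)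
      then show ?thesis using a \<open>finite L\<close> by simp
    qed
    ultimately show "u a < u q \<or> u a = u q \<and> w a \<le> w q" by auto
  qed
qed

text \<open>Under \<open>unique\<close> only one term of the convolution sum at \<open>a + b\<close>
  survives, a product of two nonzero coefficients.\<close>

lemma add_in_keys_mult:
  fixes h k :: "'a::monoid_add \<Rightarrow>\<^sub>0 'b::semiring_no_zero_divisors"
  assumes "a \<in> Poly_Mapping.keys h" and "b \<in> Poly_Mapping.keys k"
    and unique: "\<And>a' b'. a' \<in> Poly_Mapping.keys h \<Longrightarrow> b' \<in> Poly_Mapping.keys k \<Longrightarrow>
      a' + b' = a + b \<Longrightarrow> a' = a \<and> b' = b"
  shows "a + b \<in> Poly_Mapping.keys (h * k)"
proof -
  let ?H = "Poly_Mapping.keys h" and ?K = "Poly_Mapping.keys k"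
  let ?t = "\<lambda>(x, y). Poly_Mapping.lookup h x * Poly_Mapping.lookup k y when a + b = x + y"
  have "Poly_Mapping.lookup (h * k) (a + b) = Sum_any ?t"
    by (simp add: times_poly_mapping.rep_eq prod_fun_unfold_prod)
  also have "\<dots> = sum ?t (?H \<times> ?K)"
    by (rule Sum_any.expand_superset) (auto simp: in_keys_iff when_def split: if_splits)
  also have "\<dots> = sum ?t {(a, b)}"
  proof (rule sum.mono_neutral_right)
    show "\<forall>i\<in>?H \<times> ?K - {(a, b)}. ?t i = 0"
      using unique by (force simp: when_def)
  qed (use assms in auto)
  also have "\<dots> = Poly_Mapping.lookup h a * Poly_Mapping.lookup k b" by simp
  finally show ?thesis using assms by (simp add: in_keys_iff)
qed

text \<open>One step of gift wrapping: from the leftmost point \<open>a\<close>, lowest among ties,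
  the ray of least slope to a point further right runs along an edge of the lower hull. If no point
  lies further right, all points are on a vertical line, where \<open>(1, 0)\<close> is
  constant.\<close>

lemma min_attained_twice_exists:
  assumes "finite K" and "card K \<ge> 2"
  obtains v where "v \<noteq> 0" "min_attained_twice K v"
proof -
  have "K \<noteq> {}" using assms by auto
  then obtain a where a: "a \<in> K" and
    amin: "\<And>q. q \<in> K \<Longrightarrow> fst a < fst q \<or> fst a = fst q \<and> snd a \<le> snd q"
    using lexicographic_minimum_exists[OF assms(1), of fst snd] by blast
  define R where "R = {q \<in> K. fst a < fst q}"
  have "finite R" using assms by (simp add: R_def)
  show ?thesis
  proof (cases "R = {}")
    case True
    have "K \<noteq> {a}" using assms by auto
    then obtain b where "b \<in> K" "b \<noteq> a" using a by blast
    moreover have "exponent_vector q \<bullet> (1, 0) = real_of_int (fst a)" if "q \<in> K" for q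
    proof -
      have "\<not> fst a < fst q" using True that unfolding R_def by blast
      then show ?thesis using amin[OF that] by (simp add: inner_exponent_vector)
    qed
    ultimately have "min_attained_twice K (1, 0)"
      unfolding min_attained_twice_def using a
      by (intro bexI[of _ a] bexI[of _ b]) auto
    then show ?thesis using that[of "(1, 0)"] by (simp add: zero_prod_def)
  next
    case False
    define s where "s q = real_of_int (snd q - snd a) / real_of_int (fst q - fst a)" for q
    have "Min (s ` R) \<in> s ` R" using False \<open>finite R\<close> by simp
    then obtain b where b: "b \<in> R" "s b = Min (s ` R)" by force
    have smin: "s b \<le> s q" if "q \<in> R" for q using b that \<open>finite R\<close> by simp
    \<comment> \<open>The upward normal to the line through \<open>a\<close> and \<open>b\<close>,
      whose slope is \<open>s b\<close>; by \<open>smin\<close> all of \<open>R\<close> lies on or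
      above this line.\<close>
    define v where "v = (- s b, 1 :: real)"
    have pos: "0 < real_of_int (fst q - fst a)" if "q \<in> R" for q using that by (simp add: R_def)
    have slope: "exponent_vector q \<bullet> v - exponent_vector a \<bullet> v
        = real_of_int (fst q - fst a) * (s q - s b)" if "q \<in> R" for q
    proof -
      have "real_of_int (fst q - fst a) * s q = real_of_int (snd q - snd a)"
        using pos[OF that] by (simp add: s_def)
      moreover have "exponent_vector q \<bullet> v - exponent_vector a \<bullet> v
          = real_of_int (snd q - snd a) - real_of_int (fst q - fst a) * s b"
        unfolding inner_exponent_vector v_def by (simp add: algebra_simps)
      ultimately show ?thesis by (simp only: right_diff_distrib)
    qed
    have "exponent_vector a \<bullet> v \<le> exponent_vector q \<bullet> v" if "q \<in> K" for q
    proof (cases "q \<in> R")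
      case True
      have "0 \<le> real_of_int (fst q - fst a) * (s q - s b)"
        using pos[OF True] smin[OF True] by (intro mult_nonneg_nonneg) auto
      then show ?thesis using slope[OF True] by linarith
    next
      case False
      \<comment> \<open>Such a point lies straight above \<open>a\<close> or equals it, and the
        second coordinate of \<open>v\<close> is positive.\<close>
      then show ?thesis using amin[OF that] that by (simp add: R_def inner_exponent_vector v_def)
    qed
    moreover have "b \<in> K" "a \<noteq> b" using b(1) by (auto simp: R_def)
    ultimately have "min_attained_twice K v"
      unfolding min_attained_twice_def using a slope[OF b(1)]
      by (intro bexI[of _ a] bexI[of _ b]) simp_all
    then show ?thesis using that[of v] by (simp add: v_def zero_prod_def)
  qed
qed

text \<open>\<open>v\<close> and its rotation by a right angle form a basis of the plane, so the two
  inner products determine a vector.\<close>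

lemma exponent_vector_eqI:
  assumes "v \<noteq> 0"
    and "exponent_vector p \<bullet> v = exponent_vector q \<bullet> v"
    and "exponent_vector p \<bullet> (- snd v, fst v) = exponent_vector q \<bullet> (- snd v, fst v)"
  shows "p = q"
proof -
  define x y where "x = real_of_int (fst p - fst q)" and "y = real_of_int (snd p - snd q)"
  have 1: "x * fst v + y * snd v = 0" and 2: "y * fst v - x * snd v = 0"
    using assms(2,3) by (simp_all add: inner_exponent_vector x_def y_def algebra_simps)
  \<comment> \<open>The Brahmagupta-Fibonacci identity avoids a case split on which coordinate of
    \<open>v\<close> is nonzero.\<close>
  have "(x\<^sup>2 + y\<^sup>2) * ((fst v)\<^sup>2 + (snd v)\<^sup>2)
      = (x * fst v + y * snd v)\<^sup>2 + (y * fst v - x * snd v)\<^sup>2"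
    by (simp add: power2_eq_square algebra_simps)
  also have "\<dots> = 0" using 1 2 by simp
  finally have "x\<^sup>2 + y\<^sup>2 = 0 \<or> (fst v)\<^sup>2 + (snd v)\<^sup>2 = 0" by simp
  moreover have "(fst v)\<^sup>2 + (snd v)\<^sup>2 \<noteq> 0"
    using assms(1) by (simp add: sum_power2_eq_zero_iff prod_eq_iff)
  ultimately have "x\<^sup>2 + y\<^sup>2 = 0" by blast
  then have "x = 0" "y = 0" by (simp_all add: sum_power2_eq_zero_iff)
  then show ?thesis by (simp add: x_def y_def prod_eq_iff)
qed

text \<open>If \<open>a' + b' = a + b\<close>, minimality forces first the \<open>v\<close>-values
  and then the \<open>w\<close>-values of the summands to agree, and \<open>inj\<close> gives
  \<open>a' = a\<close>. Leaving \<open>w\<close> arbitrary lets both orientations of the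
  perpendicular form be used.\<close>

lemma lexicographic_minima_add_in_keys_mult:
  fixes h k :: laurent2 and w :: "real \<times> real"
  assumes inj: "\<And>p q. exponent_vector p \<bullet> v = exponent_vector q \<bullet> v \<Longrightarrow>
      exponent_vector p \<bullet> w = exponent_vector q \<bullet> w \<Longrightarrow> p = q"
    and a: "a \<in> Poly_Mapping.keys h" "\<And>q. q \<in> Poly_Mapping.keys h \<Longrightarrow>
      exponent_vector a \<bullet> v < exponent_vector q \<bullet> v \<or>
      exponent_vector a \<bullet> v = exponent_vector q \<bullet> v \<and> exponent_vector a \<bullet> w \<le> exponent_vector q \<bullet> w"
    and b: "b \<in> Poly_Mapping.keys k" "\<And>q. q \<in> Poly_Mapping.keys k \<Longrightarrow>
      exponent_vector b \<bullet> v < exponent_vector q \<bullet> v \<or>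
      exponent_vector b \<bullet> v = exponent_vector q \<bullet> v \<and> exponent_vector b \<bullet> w \<le> exponent_vector q \<bullet> w"
  shows "a + b \<in> Poly_Mapping.keys (h * k)"
proof (rule add_in_keys_mult[OF a(1) b(1)])
  fix a' b' assume a': "a' \<in> Poly_Mapping.keys h" and b': "b' \<in> Poly_Mapping.keys k"
    and eq: "a' + b' = a + b"
  have "exponent_vector a' + exponent_vector b' = exponent_vector a + exponent_vector b"
    using eq by (metis exponent_vector_add)
  then have sum: "exponent_vector a' \<bullet> u + exponent_vector b' \<bullet> u
      = exponent_vector a \<bullet> u + exponent_vector b \<bullet> u" for u
    by (metis inner_add_left)
  have "exponent_vector a \<bullet> v = exponent_vector a' \<bullet> v" "exponent_vector a \<bullet> w = exponent_vector a' \<bullet> w"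
    using a(2)[OF a'] b(2)[OF b'] sum[of v] sum[of w] by linarith+
  then have "a = a'" by (rule inj)
  then show "a' = a \<and> b' = b" using eq by simp
qed

text \<open>The minimal face of a Minkowski sum is the sum of the minimal faces. That of
  \<open>h\<close> has positive extent along \<open>w\<close>, and adding that of \<open>k\<close>
  cannot shrink it.\<close>

lemma min_attained_twice_mult:
  fixes h k :: laurent2
  assumes "v \<noteq> 0" and "min_attained_twice (Poly_Mapping.keys h) v" and "k \<noteq> 0"
  shows "min_attained_twice (Poly_Mapping.keys (h * k)) v"
proof -
  let ?H = "Poly_Mapping.keys h" and ?K = "Poly_Mapping.keys k"
  let ?v = "\<lambda>p. exponent_vector p \<bullet> v"
  define w where "w = (- snd v, fst v)"
  let ?w = "\<lambda>p. exponent_vector p \<bullet> w" and ?w' = "\<lambda>p. exponent_vector p \<bullet> (- w)"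
  obtain p q where pq: "p \<in> ?H" "q \<in> ?H" "p \<noteq> q" "?v p = ?v q" "\<And>r. r \<in> ?H \<Longrightarrow> ?v p \<le> ?v r"
    using assms(2) unfolding min_attained_twice_def by blast
  have inj: "x = y" if "?v x = ?v y" "?w x = ?w y" for x y
    using exponent_vector_eqI[OF assms(1)] that unfolding w_def by blast
  have ne: "?H \<noteq> {}" "?K \<noteq> {}" using pq(1) assms(3) by auto
  obtain a1 where a1: "a1 \<in> ?H" "\<And>q. q \<in> ?H \<Longrightarrow> ?v a1 < ?v q \<or> ?v a1 = ?v q \<and> ?w a1 \<le> ?w q"
    using lexicographic_minimum_exists[OF finite_keys ne(1), of ?v ?w] by blast
  obtain a2 where a2: "a2 \<in> ?H" "\<And>q. q \<in> ?H \<Longrightarrow> ?v a2 < ?v q \<or> ?v a2 = ?v q \<and> ?w' a2 \<le> ?w' q"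
    using lexicographic_minimum_exists[OF finite_keys ne(1), of ?v ?w'] by blast
  obtain b1 where b1: "b1 \<in> ?K" "\<And>q. q \<in> ?K \<Longrightarrow> ?v b1 < ?v q \<or> ?v b1 = ?v q \<and> ?w b1 \<le> ?w q"
    using lexicographic_minimum_exists[OF finite_keys ne(2), of ?v ?w] by blast
  obtain b2 where b2: "b2 \<in> ?K" "\<And>q. q \<in> ?K \<Longrightarrow> ?v b2 < ?v q \<or> ?v b2 = ?v q \<and> ?w' b2 \<le> ?w' q"
    using lexicographic_minimum_exists[OF finite_keys ne(2), of ?v ?w'] by blast
  have mem1: "a1 + b1 \<in> Poly_Mapping.keys (h * k)"
    by (rule lexicographic_minima_add_in_keys_mult[OF inj a1 b1])
  have mem2: "a2 + b2 \<in> Poly_Mapping.keys (h * k)"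
    by (rule lexicographic_minima_add_in_keys_mult[OF _ a2 b2])
      (simp_all only: inner_minus_right neg_equal_iff_equal inj)
  have va: "?v a1 = ?v p" "?v a2 = ?v p"
    using a1(2)[OF pq(1)] pq(5)[OF a1(1)] a2(2)[OF pq(1)] pq(5)[OF a2(1)] by linarith+
  have vb: "?v b1 = ?v b2" "?w b1 \<le> ?w b2"
    using b1(2)[OF b2(1)] b2(2)[OF b1(1)] by auto
  \<comment> \<open>As \<open>p\<close> and \<open>q\<close> tie under \<open>v\<close>,
    \<open>w\<close> separates them; both \<open>w\<close>-values lie between those of
    \<open>a1\<close> and \<open>a2\<close>, which therefore differ strictly.\<close>
  have "?w p \<noteq> ?w q" using inj[OF pq(4)] pq(3) by blast
  moreover have "?w a1 \<le> ?w p" "?w a1 \<le> ?w q" "?w p \<le> ?w a2" "?w q \<le> ?w a2"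
    using a1(2)[OF pq(1)] a1(2)[OF pq(2)] a2(2)[OF pq(1)] a2(2)[OF pq(2)] va pq(4) by auto
  ultimately have "?w (a1 + b1) \<noteq> ?w (a2 + b2)"
    using vb(2) by (simp add: exponent_vector_add inner_add_left)
  then have neq: "a1 + b1 \<noteq> a2 + b2" by metis
  have "?v (a1 + b1) \<le> ?v r" if r: "r \<in> Poly_Mapping.keys (h * k)" for r
  proof -
    obtain x y where xy: "r = x + y" "x \<in> ?H" "y \<in> ?K" using r keys_mult[of h k] by blast
    then show ?thesis using a1(2)[OF xy(2)] b1(2)[OF xy(3)]
      by (auto simp: exponent_vector_add inner_add_left)
  qed
  moreover have "?v (a1 + b1) = ?v (a2 + b2)"
    using va vb by (simp add: exponent_vector_add inner_add_left)
  ultimately show ?thesis unfolding min_attained_twice_def using mem1 mem2 neq by blast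
qed

text \<open>The supporting line normal to \<open>v\<close> cuts out a face. Two distinct exponents
  on it give dimension at least one, the line gives at most one, so the face is an edge.\<close>

lemma min_attained_twice_imp_Trop:
  assumes "v \<noteq> 0" and "min_attained_twice (Poly_Mapping.keys f) v"
  shows "v \<in> Trop f"
proof -
  let ?P = "newton_polygon f"
  obtain p q where pq: "p \<in> Poly_Mapping.keys f" "q \<in> Poly_Mapping.keys f" "p \<noteq> q"
    "exponent_vector p \<bullet> v = exponent_vector q \<bullet> v"
    "\<And>r. r \<in> Poly_Mapping.keys f \<Longrightarrow> exponent_vector p \<bullet> v \<le> exponent_vector r \<bullet> v"
    using assms(2) unfolding min_attained_twice_def by blast
  define m where "m = exponent_vector p \<bullet> v"
  \<comment> \<open>The bound passes from the support to its hull because a half-plane is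
    convex.\<close>
  have "?P \<subseteq> {x. v \<bullet> x \<ge> m}"
    unfolding newton_polygon_eq using pq(5)
    by (intro hull_minimal convex_halfspace_ge) (auto simp: m_def inner_commute)
  then have Pge: "v \<bullet> x \<ge> m" if "x \<in> ?P" for x using that by auto
  define F where "F = ?P \<inter> {x. v \<bullet> x = m}"
  have convP: "convex ?P" and compP: "compact ?P"
    unfolding newton_polygon_eq by (auto intro!: finite_imp_compact_convex_hull)
  have face: "F face_of ?P"
    unfolding F_def by (rule face_of_Int_supporting_hyperplane_ge[OF convP Pge])
  have "{exponent_vector p, exponent_vector q} \<subseteq> F"
    using pq by (auto simp: F_def newton_polygon_eq m_def inner_commute intro: hull_inc)
  then have "aff_dim {exponent_vector p, exponent_vector q} \<le> aff_dim F" by (rule aff_dim_subset)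
  then have "1 \<le> aff_dim F" using pq(3) by (simp add: exponent_vector_eq_iff)
  moreover have "aff_dim F \<le> aff_dim {x. v \<bullet> x = m}"
    by (rule aff_dim_subset) (auto simp: F_def)
  then have "aff_dim F \<le> 1" using assms(1) by simp
  ultimately have dim: "aff_dim F = 1" by simp
  have "compact F" "convex F" "F \<noteq> {}" "collinear F"
    using face_of_imp_compact[OF convP compP face] face_of_imp_convex[OF face] dim
    by (auto simp: collinear_aff_dim)
  \<comment> \<open>\<open>p\<close> and \<open>q\<close> may be interior to the edge, so the
    witnesses for \<open>Trop\<close> are the ends of the segment \<open>F\<close>.\<close>
  then obtain p1 p2 where seg: "F = closed_segment p1 p2"
    using compact_convex_collinear_segment by blast
  then have "p1 \<in> F" "p2 \<in> F" by auto
  then have "v \<in> edge_normal_cone ?P p1 p2"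
    using Pge assms(1)
    by (fastforce simp: edge_normal_cone_def is_arg_min_linorder F_def inner_commute)
  moreover have "closed_segment p1 p2 edge_of ?P"
    using face dim seg by (simp add: edge_of_def)
  ultimately show ?thesis unfolding Trop_def by blast
qed

text \<open>Exponents form a group, so the opposite exponent yields an inverse monomial.\<close>

lemma single_dvd_one:
  fixes c :: "'b::field"
  assumes "c \<noteq> 0"
  shows "Poly_Mapping.single (a :: 'a::ab_group_add) c dvd 1"
proof
  show "1 = Poly_Mapping.single a c * Poly_Mapping.single (- a) (inverse c)"
    using assms by (simp add: mult_single)
qed

text \<open>A singleton support makes \<open>h\<close> a monomial, hence a unit. This reduces the
  claim about non-units to the claim about two monomials.\<close>

lemma card_keys_ge_2_if_not_unit:
  fixes h :: "'a::ab_group_add \<Rightarrow>\<^sub>0 'b::field"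
  assumes "h \<noteq> 0" and "\<not> h dvd 1"
  shows "card (Poly_Mapping.keys h) \<ge> 2"
proof (rule ccontr)
  assume "\<not> ?thesis"
  moreover have "card (Poly_Mapping.keys h) \<noteq> 0" using assms(1) by simp
  ultimately have "card (Poly_Mapping.keys h) = 1" by linarith
  then obtain a where a: "Poly_Mapping.keys h = {a}" by (rule card_1_singletonE)
  have "h = Poly_Mapping.single a (Poly_Mapping.lookup h a)"
    by (rule poly_mapping_eqI) (use a in \<open>auto simp: lookup_single when_def in_keys_iff\<close>)
  moreover have "Poly_Mapping.lookup h a \<noteq> 0" using a by (auto simp flip: in_keys_iff)
  ultimately show False using assms(2) single_dvd_one by metis
qed

theorem proposition4p2:
  fixes f g :: laurent2
  assumes "f \<noteq> 0" and "g \<noteq> 0"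
    and "Trop f \<inter> Trop g = {}"
  shows "\<not> (\<exists>h. \<not> h dvd 1 \<and> h dvd f \<and> h dvd g) \<and>
         \<not> (\<exists>h. card (Poly_Mapping.keys h) \<ge> 2 \<and> h dvd f \<and> h dvd g)"
proof -
  have no_factor: False
    if card: "card (Poly_Mapping.keys h) \<ge> 2" and "h dvd f" and "h dvd g" for h
  proof -
    obtain v where v: "v \<noteq> 0" "min_attained_twice (Poly_Mapping.keys h) v"
      using min_attained_twice_exists[OF finite_keys card] by blast
    \<comment> \<open>\<open>v\<close> was chosen from \<open>h\<close> alone, so the same vector
      serves for both \<open>f\<close> and \<open>g\<close>.\<close>
    have "v \<in> Trop F" if "h dvd F" "F \<noteq> 0" for F
    proof -
      obtain k where k: "F = h * k" using \<open>h dvd F\<close> by (rule dvdE)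
      then have "k \<noteq> 0" using \<open>F \<noteq> 0\<close> by auto
      then show ?thesis
        unfolding k by (intro min_attained_twice_imp_Trop min_attained_twice_mult v)
    qed
    then show False using that assms by blast
  qed
  \<comment> \<open>This excludes zero, the only non-unit with fewer than two monomials.\<close>
  moreover have "h \<noteq> 0" if "h dvd f" for h using that assms(1) by auto
  ultimately show ?thesis using card_keys_ge_2_if_not_unit by blast
qed

end
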